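(* Let $L=\sum_{j=0}^{m}p_j(x)D^j$ be a polynomial differential operator (each $p_j$ a polynomial), let $N_{t,s}=P_{t,s}LP_{t,s}^{-1}$ be its Heat--Airy transport and $N_t^H=P_t^HL(P_t^H)^{-1}$ its Heat transport. Let $I\subset\mathbb R^2$ be open, let $f:I\to\mathbb R$ be smooth, and let $v=v(t,s,x)$ be a smooth function on $I\times\mathbb R$ such that $$v_t=\tfrac12 v_{xx},\qquad v_s=-\tfrac13 v_{xxx},\qquad N_{t,s}v=0 ,\qquad v(t,s,f(t,s))=0 .$$ Put $u(t,x)=v(t,0,x)$ and $F(t)=f(t,0)$ for those $t$ with $(t,0)\in I$. Then for every integer $r\ge 0$ and every $t$ with $(t,0)\in I$, $$\left.\gamma_f\bigl(D^r(N_{t,s}v)\bigr)\right|_{s=0}=\gamma_F\bigl(D^r(N_t^Hu)\bigr).$$ Consequently, every finite collection of spatial-jet equations $\gamma_F(D^r(N_t^Hu))=0$ of the pure Heat problem is obtained by restricting the corresponding Heat--Airy spatial-jet equations $\gamma_f(D^r(N_{t,s}v))=0$ to the slice $s=0$.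
   Context: $D=\partial/\partial x$ denotes differentiation in the spatial variable. $P_{t,s}=\exp\left(\frac t2D^2-\frac s3D^3\right)$ and $P_t^H=\exp\left(\frac t2D^2\right)$; these act on polynomials in $x$ by finite exponential series and are invertible there. Conjugation by $P_{t,s}$ fixes $D$ and sends multiplication by $x$ to $X_{t,s}=x+tD-sD^2$, so that the transport is the polynomial differential operator $N_{t,s}=\sum_{j=0}^m p_j(X_{t,s})D^j$ (operator products), which is then applied to smooth functions of $x$. Likewise $N_t^H=\sum_{j=0}^m p_j(x+tD)D^j$. For a function $w(t,s,x)$, $\gamma_f(w)=w(t,s,f(t,s))$; for a function $w(t,x)$, $\gamma_F(w)=w(t,F(t))$. *)

theory Defs
  imports "HOL-Analysis.Analysis" "HOL-Computational_Algebra.Polynomial"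
begin

section \<open>Smooth functions\<close>

primrec Ck_on :: "nat \<Rightarrow> 'a::real_normed_vector set \<Rightarrow> ('a \<Rightarrow> 'b::real_normed_vector) \<Rightarrow> bool" where
  "Ck_on 0 S g \<longleftrightarrow> continuous_on S g"
| "Ck_on (Suc k) S g \<longleftrightarrow> (\<forall>x\<in>S. g differentiable (at x)) \<and>
     (\<forall>h. Ck_on k S (\<lambda>x. frechet_derivative g (at x) h))"

text \<open>Intended for open \<open>S\<close> in a Euclidean space. The second clause above asks that every
  directional derivative be of the preceding class, which there is the same as asking it of the
  partial derivatives.\<close>

definition smooth_on :: "'a::real_normed_vector set \<Rightarrow> ('a \<Rightarrow> 'b::real_normed_vector) \<Rightarrow> bool" where
  "smooth_on S g \<longleftrightarrow> (\<forall>k. Ck_on k S g)"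


section \<open>Polynomial differential operators\<close>

text \<open>\<open>L :: real poly poly\<close> encodes \<open>\<Sum>\<^sub>j p\<^sub>j(x) D\<^sup>j\<close> with \<open>p\<^sub>j = coeff L j\<close>: the outer
  indeterminate stands for \<open>D\<close> and is written to the right of the coefficients. The ring
  multiplication of \<open>real poly poly\<close> is \<^emph>\<open>not\<close> the composition of operators and is not used.\<close>

definition op_poly :: "real poly poly \<Rightarrow> real poly \<Rightarrow> real poly" where
  "op_poly L q = (\<Sum>j\<le>degree L. coeff L j * (pderiv ^^ j) q)"

definition op_fun :: "real poly poly \<Rightarrow> (real \<Rightarrow> real) \<Rightarrow> real \<Rightarrow> real" where
  "op_fun L g = (\<lambda>x. \<Sum>j\<le>degree L. poly (coeff L j) x * (deriv ^^ j) g x)"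


section \<open>Heat--Airy and Heat transport\<close>

text \<open>The exponential series is used for operators \<open>A\<close> that lower the degree, so that
  \<open>A\<^sup>n q = 0\<close> for \<open>n > degree q\<close>.\<close>

definition exp_op :: "(real poly \<Rightarrow> real poly) \<Rightarrow> real poly \<Rightarrow> real poly" where
  "exp_op A q = (\<Sum>n\<le>degree q. smult (1 / fact n) ((A ^^ n) q))"

definition heat_airy_P :: "real \<Rightarrow> real \<Rightarrow> real poly \<Rightarrow> real poly" where
  "heat_airy_P t s =
     exp_op (\<lambda>q. smult (t / 2) ((pderiv ^^ 2) q) - smult (s / 3) ((pderiv ^^ 3) q))"

definition heat_P :: "real \<Rightarrow> real poly \<Rightarrow> real poly" where
  "heat_P t = exp_op (\<lambda>q. smult (t / 2) ((pderiv ^^ 2) q))"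

text \<open>The polynomial differential operator that acts on polynomials as \<open>P L P\<^sup>-\<^sup>1\<close>. For
  \<open>P = heat_airy_P t s\<close> and \<open>P = heat_P t\<close>, the lemmas below show that \<open>P\<close> is
  bijective and that this operator exists and is unique, and that on functions it acts as
  \<open>\<Sum>\<^sub>j p\<^sub>j(P x P\<^sup>-\<^sup>1) D\<^sup>j\<close>.\<close>

definition conj_op :: "(real poly \<Rightarrow> real poly) \<Rightarrow> real poly poly \<Rightarrow> real poly poly" where
  "conj_op P L = (THE N. \<forall>q. op_poly N q = P (op_poly L (inv P q)))"

definition heat_airy_N :: "real poly poly \<Rightarrow> real \<Rightarrow> real \<Rightarrow> real poly poly" where
  "heat_airy_N L t s = conj_op (heat_airy_P t s) L"

definition heat_N :: "real poly poly \<Rightarrow> real \<Rightarrow> real poly poly" where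
  "heat_N L t = conj_op (heat_P t) L"


section \<open>Boundary traces and spatial jets\<close>

definition gamma2 :: "(real \<Rightarrow> real \<Rightarrow> real) \<Rightarrow> (real \<Rightarrow> real \<Rightarrow> real \<Rightarrow> real) \<Rightarrow> real \<Rightarrow> real \<Rightarrow> real" where
  "gamma2 f w t s = w t s (f t s)"

definition gamma1 :: "(real \<Rightarrow> real) \<Rightarrow> (real \<Rightarrow> real \<Rightarrow> real) \<Rightarrow> real \<Rightarrow> real" where
  "gamma1 F w t = w t (F t)"

definition heat_airy_jet ::
  "real poly poly \<Rightarrow> (real \<Rightarrow> real \<Rightarrow> real) \<Rightarrow> (real \<Rightarrow> real \<Rightarrow> real \<Rightarrow> real) \<Rightarrow> nat \<Rightarrow> real \<Rightarrow> real \<Rightarrow> real" where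
  "heat_airy_jet L f v r = gamma2 f (\<lambda>t s. (deriv ^^ r) (op_fun (heat_airy_N L t s) (v t s)))"

definition heat_jet ::
  "real poly poly \<Rightarrow> (real \<Rightarrow> real) \<Rightarrow> (real \<Rightarrow> real \<Rightarrow> real) \<Rightarrow> nat \<Rightarrow> real \<Rightarrow> real" where
  "heat_jet L F u r = gamma1 F (\<lambda>t. (deriv ^^ r) (op_fun (heat_N L t) (u t)))"


section \<open>The transport is well defined and equals the operator-product formula\<close>

definition heat_airy_X :: "real \<Rightarrow> real \<Rightarrow> (real \<Rightarrow> real) \<Rightarrow> real \<Rightarrow> real" where
  "heat_airy_X t s g = (\<lambda>x. x * g x + t * deriv g x - s * (deriv ^^ 2) g x)"

definition heat_X :: "real \<Rightarrow> (real \<Rightarrow> real) \<Rightarrow> real \<Rightarrow> real" where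
  "heat_X t g = (\<lambda>x. x * g x + t * deriv g x)"

definition poly_of_op :: "real poly \<Rightarrow> ((real \<Rightarrow> real) \<Rightarrow> real \<Rightarrow> real) \<Rightarrow> (real \<Rightarrow> real) \<Rightarrow> real \<Rightarrow> real" where
  "poly_of_op p A g = (\<lambda>x. \<Sum>i\<le>degree p. coeff p i * (A ^^ i) g x)"

subsection \<open>Actions of operators\<close>

lemma smult_sum_right: "smult c (\<Sum>i\<in>S. h i) = (\<Sum>i\<in>S. smult c (h i))"
  by (induction S rule: infinite_finite_induct) (simp_all add: smult_add_right)

lemma op_poly_bound:
  assumes "degree L \<le> n"
  shows "op_poly L q = (\<Sum>j\<le>n. coeff L j * (pderiv ^^ j) q)"
  unfolding op_poly_def
  by (rule sum.mono_neutral_left) (use assms in \<open>auto simp: coeff_eq_0\<close>)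

lemma op_fun_bound:
  assumes "degree L \<le> n"
  shows "op_fun L g x = (\<Sum>j\<le>n. poly (coeff L j) x * (deriv ^^ j) g x)"
  unfolding op_fun_def
  by (rule sum.mono_neutral_left) (use assms in \<open>auto simp: coeff_eq_0\<close>)

lemma op_poly_0 [simp]: "op_poly 0 q = 0"
  by (simp add: op_poly_def)

lemma op_fun_0 [simp]: "op_fun 0 g x = 0"
  by (simp add: op_fun_def)

lemma op_poly_pCons: "op_poly (pCons a L) q = a * q + op_poly L (pderiv q)"
proof -
  have "op_poly (pCons a L) q = (\<Sum>j\<le>Suc (degree L). coeff (pCons a L) j * (pderiv ^^ j) q)"
    by (rule op_poly_bound) (rule degree_pCons_le)
  also have "\<dots> = a * q + (\<Sum>j\<le>degree L. coeff L j * (pderiv ^^ Suc j) q)"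
    by (subst sum.atMost_Suc_shift) simp
  finally show ?thesis
    by (simp add: op_poly_def funpow_Suc_right del: funpow.simps)
qed

lemma op_fun_pCons: "op_fun (pCons a L) g x = poly a x * g x + op_fun L (deriv g) x"
proof -
  have "op_fun (pCons a L) g x = (\<Sum>j\<le>Suc (degree L). poly (coeff (pCons a L) j) x * (deriv ^^ j) g x)"
    by (rule op_fun_bound) (rule degree_pCons_le)
  also have "\<dots> = poly a x * g x + (\<Sum>j\<le>degree L. poly (coeff L j) x * (deriv ^^ Suc j) g x)"
    by (subst sum.atMost_Suc_shift) simp
  finally show ?thesis
    by (simp add: op_fun_def funpow_Suc_right del: funpow.simps)
qed

lemma op_poly_add: "op_poly (A + B) q = op_poly A q + op_poly B q"
  by (induction A B arbitrary: q rule: poly_induct2) (simp_all add: op_poly_pCons algebra_simps)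

lemma op_fun_add: "op_fun (A + B) g x = op_fun A g x + op_fun B g x"
  by (induction A B arbitrary: g rule: poly_induct2) (simp_all add: op_fun_pCons algebra_simps)

lemma op_poly_smult: "op_poly (smult c A) q = c * op_poly A q"
  by (induction A arbitrary: q) (simp_all add: op_poly_pCons algebra_simps)

lemma op_fun_smult: "op_fun (smult c A) g x = poly c x * op_fun A g x"
  by (induction A arbitrary: g) (simp_all add: op_fun_pCons algebra_simps)

lemma op_poly_diff: "op_poly (A - B) q = op_poly A q - op_poly B q"
  using op_poly_add[of "A - B" B q] by simp

lemma op_fun_diff: "op_fun (A - B) g x = op_fun A g x - op_fun B g x"
  using op_fun_add[of "A - B" B g x] by simp

lemma op_poly_sum: "op_poly (\<Sum>i\<in>S. A i) q = (\<Sum>i\<in>S. op_poly (A i) q)"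
  by (induction S rule: infinite_finite_induct) (simp_all add: op_poly_add)

lemma op_fun_sum: "op_fun (\<Sum>i\<in>S. A i) g x = (\<Sum>i\<in>S. op_fun (A i) g x)"
  by (induction S rule: infinite_finite_induct) (simp_all add: op_fun_add)

lemma op_poly_monom: "op_poly (monom 1 j) q = (pderiv ^^ j) q"
  by (induction j arbitrary: q)
     (simp_all add: monom_0 monom_Suc op_poly_pCons funpow_Suc_right del: funpow.simps(2))

lemma op_fun_monom: "op_fun (monom 1 j) g x = (deriv ^^ j) g x"
  by (induction j arbitrary: g)
     (simp_all add: monom_0 monom_Suc op_fun_pCons funpow_Suc_right del: funpow.simps(2))

lemma op_poly_inject:
  assumes "\<And>q. op_poly A q = op_poly B q"
  shows "A = B"
proof -
  define C where "C = A - B"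
  have z: "op_poly C q = 0" for q
    using assms[of q] by (simp add: C_def op_poly_diff)
  have "coeff C n = 0" for n
  proof (induction n rule: less_induct)
    case (less n)
    have "0 = op_poly C (monom 1 n)"
      by (simp add: z)
    also have "\<dots> = (\<Sum>j\<le>max (degree C) n. coeff C j * (pderiv ^^ j) (monom 1 n))"
      by (rule op_poly_bound) simp
    also have "\<dots> = (\<Sum>j\<in>{n}. coeff C j * (pderiv ^^ j) (monom 1 n))"
    proof (rule sum.mono_neutral_right, goal_cases)
      case 3
      show ?case
      proof
        fix j assume "j \<in> {..max (degree C) n} - {n}"
        then consider "j < n" | "j > n" by fastforce
        then show "coeff C j * (pderiv ^^ j) (monom 1 n) = 0"
        proof cases
          case 1
          then show ?thesis by (simp add: less.IH)
        next
          case 2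
          then have "(pderiv ^^ j) (monom 1 n) = (0 :: real poly)"
            by (intro poly_eqI) (simp add: coeff_higher_pderiv)
          then show ?thesis by simp
        qed
      qed
    qed auto
    finally have "coeff C n * (pderiv ^^ n) (monom 1 n) = 0"
      by simp
    moreover have "coeff ((pderiv ^^ n) (monom 1 n)) 0 \<noteq> (0 :: real)"
      by (simp add: coeff_higher_pderiv pochhammer_fact [symmetric])
    ultimately show ?case
      by auto
  qed
  then have "C = 0"
    by (simp add: poly_eq_iff)
  then show ?thesis
    by (simp add: C_def)
qed

subsection \<open>Composition on the left with \<open>D\<close> and with \<open>X\<close>\<close>

definition D_left :: "real poly poly \<Rightarrow> real poly poly" where
  "D_left A = pCons 0 A + map_poly pderiv A"

definition X_left :: "real \<Rightarrow> real \<Rightarrow> real poly poly \<Rightarrow> real poly poly" where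
  "X_left t s A = smult [:0, 1:] A + smult [:t:] (D_left A) - smult [:s:] (D_left (D_left A))"

definition poly_X :: "real \<Rightarrow> real \<Rightarrow> real poly \<Rightarrow> real poly" where
  "poly_X t s q = pCons 0 q + smult t (pderiv q) - smult s (pderiv (pderiv q))"

lemma op_poly_D_left: "op_poly (D_left A) q = pderiv (op_poly A q)"
proof -
  have "op_poly (map_poly pderiv A) q = pderiv (op_poly A q) - op_poly A (pderiv q)"
    by (induction A arbitrary: q)
       (simp_all add: map_poly_pCons op_poly_pCons pderiv_add pderiv_mult algebra_simps)
  then show ?thesis
    by (simp add: D_left_def op_poly_add op_poly_pCons)
qed

lemma op_fun_D_left:
  assumes "\<And>n x. (deriv ^^ n) g field_differentiable (at x)"
  shows "deriv (op_fun A g) = op_fun (D_left A) g"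
proof
  fix x
  have "((op_fun A g) has_field_derivative (op_fun (map_poly pderiv A) g x + op_fun A (deriv g) x)) (at x)"
    using assms
  proof (induction A arbitrary: g)
    case 0
    then show ?case by (simp add: op_fun_def)
  next
    case (pCons a A)
    have g: "(g has_field_derivative deriv g x) (at x)"
      using pCons.prems[of 0 x] by (simp add: field_differentiable_derivI)
    have "\<And>n x. (deriv ^^ n) (deriv g) field_differentiable at x"
      using pCons.prems[of "Suc n" for n] by (simp add: funpow_Suc_right del: funpow.simps)
    then have IH: "(op_fun A (deriv g) has_field_derivative
        (op_fun (map_poly pderiv A) (deriv g) x + op_fun A (deriv (deriv g)) x)) (at x)"
      by (rule pCons.IH)
    have eq: "op_fun (pCons a A) g = (\<lambda>x. poly a x * g x + op_fun A (deriv g) x)"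
      by (simp add: op_fun_pCons fun_eq_iff)
    show ?case
      unfolding eq
      by (rule derivative_eq_intros poly_DERIV g IH refl)+
         (simp add: map_poly_pCons op_fun_pCons algebra_simps)
  qed
  then show "deriv (op_fun A g) x = op_fun (D_left A) g x"
    by (simp add: DERIV_imp_deriv D_left_def op_fun_add op_fun_pCons)
qed

lemma op_poly_X_left: "op_poly (X_left t s A) q = poly_X t s (op_poly A q)"
  by (simp add: X_left_def poly_X_def op_poly_add op_poly_diff op_poly_smult op_poly_D_left)

lemma op_fun_X_left:
  assumes "\<And>n x. (deriv ^^ n) g field_differentiable (at x)"
  shows "op_fun (X_left t s A) g = heat_airy_X t s (op_fun A g)"
  by (simp add: X_left_def heat_airy_X_def op_fun_add op_fun_diff op_fun_smult
        op_fun_D_left[OF assms] numeral_2_eq_2 fun_eq_iff)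

definition product_form :: "real \<Rightarrow> real \<Rightarrow> real poly poly \<Rightarrow> real poly poly" where
  "product_form t s L = (\<Sum>j\<le>degree L. \<Sum>i\<le>degree (coeff L j).
     smult [:coeff (coeff L j) i:] ((X_left t s ^^ i) (monom 1 j)))"

lemma op_poly_product_form:
  "op_poly (product_form t s L) q =
    (\<Sum>j\<le>degree L. \<Sum>i\<le>degree (coeff L j). smult (coeff (coeff L j) i) ((poly_X t s ^^ i) ((pderiv ^^ j) q)))"
proof -
  have "op_poly ((X_left t s ^^ i) A) q = (poly_X t s ^^ i) (op_poly A q)" for i A
    by (induction i) (simp_all add: op_poly_X_left)
  then show ?thesis
    by (simp add: product_form_def op_poly_sum op_poly_smult op_poly_monom)
qed

lemma op_fun_product_form:
  assumes "\<And>n x. (deriv ^^ n) g field_differentiable (at x)"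
  shows "op_fun (product_form t s L) g x =
    (\<Sum>j\<le>degree L. poly_of_op (coeff L j) (heat_airy_X t s) ((deriv ^^ j) g) x)"
proof -
  have "op_fun ((X_left t s ^^ i) A) g = (heat_airy_X t s ^^ i) (op_fun A g)" for i A
    by (induction i) (simp_all add: op_fun_X_left[OF assms])
  moreover have "op_fun (monom 1 j) g = (deriv ^^ j) g" for j
    by (simp add: op_fun_monom fun_eq_iff)
  ultimately show ?thesis
    by (simp add: product_form_def op_fun_sum op_fun_smult poly_of_op_def)
qed

subsection \<open>The exponential \<open>heat_airy_P\<close> on polynomials\<close>

definition gen :: "real \<Rightarrow> real \<Rightarrow> real poly \<Rightarrow> real poly" where
  "gen t s q = smult (t / 2) ((pderiv ^^ 2) q) - smult (s / 3) ((pderiv ^^ 3) q)"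

lemma heat_airy_P_gen: "heat_airy_P t s = exp_op (gen t s)"
  by (simp add: heat_airy_P_def gen_def [abs_def])

lemma heat_P_eq: "heat_P t = heat_airy_P t 0"
  by (simp add: heat_P_def heat_airy_P_def)

lemma gen_pderiv: "gen t s q = pderiv (smult (t / 2) (pderiv q) - smult (s / 3) (pderiv (pderiv q)))"
  by (simp add: gen_def pderiv_diff pderiv_smult numeral_2_eq_2 numeral_3_eq_3)

lemma gen_0 [simp]: "gen t s 0 = 0"
  by (simp add: gen_def)

lemma gen_add: "gen t s (p + q) = gen t s p + gen t s q"
  by (simp add: gen_def higher_pderiv_add smult_add_right)

lemma gen_smult: "gen t s (smult c q) = smult c (gen t s q)"
  by (simp add: gen_def higher_pderiv_smult smult_diff_right mult.commute)

lemma gen_comm_pderiv: "gen t s (pderiv q) = pderiv (gen t s q)"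
  by (simp add: gen_def pderiv_diff pderiv_smult numeral_2_eq_2 numeral_3_eq_3)

lemma degree_gen: "degree (gen t s q) \<le> degree q - 1"
  unfolding gen_def
  by (rule degree_diff_le; rule order_trans[OF degree_smult_le]) (simp_all add: degree_higher_pderiv)

lemma gen_const: "degree q = 0 \<Longrightarrow> gen t s q = 0"
  by (auto simp: gen_def numeral_2_eq_2 numeral_3_eq_3 pderiv_pCons elim!: degree_eq_zeroE)

lemma gen_pow_0 [simp]: "(gen t s ^^ n) 0 = 0"
  by (induction n) simp_all

lemma gen_pow_eq_0: "n > degree q \<Longrightarrow> (gen t s ^^ n) q = 0"
proof (induction n arbitrary: q)
  case (Suc n)
  show ?case
  proof (cases "degree q = 0")
    case True
    then show ?thesis
      by (simp add: funpow_Suc_right gen_const del: funpow.simps)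
  next
    case False
    have "degree (gen t s q) < n"
      using degree_gen[of t s q] False Suc.prems by linarith
    then show ?thesis
      by (simp add: funpow_Suc_right Suc.IH del: funpow.simps)
  qed
qed simp

lemma gen_pow_add: "(gen t s ^^ n) (p + q) = (gen t s ^^ n) p + (gen t s ^^ n) q"
  by (induction n) (simp_all add: gen_add)

lemma gen_pow_smult: "(gen t s ^^ n) (smult c q) = smult c ((gen t s ^^ n) q)"
  by (induction n) (simp_all add: gen_smult)

lemma gen_pow_pderiv: "(gen t s ^^ n) (pderiv q) = pderiv ((gen t s ^^ n) q)"
  by (induction n) (simp_all add: gen_comm_pderiv)

lemma P_bound:
  assumes "degree q \<le> n"
  shows "heat_airy_P t s q = (\<Sum>k\<le>n. smult (1 / fact k) ((gen t s ^^ k) q))"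
  unfolding heat_airy_P_gen exp_op_def
  by (rule sum.mono_neutral_left) (use assms in \<open>auto simp: gen_pow_eq_0\<close>)

lemma P_add: "heat_airy_P t s (p + q) = heat_airy_P t s p + heat_airy_P t s q"
proof -
  let ?n = "max (degree p) (degree q)"
  have "degree (p + q) \<le> ?n" by (rule degree_add_le_max)
  then show ?thesis
    by (simp add: P_bound[where n = ?n] gen_pow_add smult_add_right sum.distrib)
qed

lemma P_smult: "heat_airy_P t s (smult c q) = smult c (heat_airy_P t s q)"
proof -
  have "degree (smult c q) \<le> degree q" by (rule degree_smult_le)
  then show ?thesis
    by (simp add: P_bound[where n = "degree q"] gen_pow_smult smult_sum_right mult.commute)
qed

lemma P_0 [simp]: "heat_airy_P t s 0 = 0"
  using P_smult[of t s 0 0] by simp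

lemma P_sum: "heat_airy_P t s (\<Sum>i\<in>S. q i) = (\<Sum>i\<in>S. heat_airy_P t s (q i))"
  by (induction S rule: infinite_finite_induct) (simp_all add: P_add)

lemma P_diff: "heat_airy_P t s (p - q) = heat_airy_P t s p - heat_airy_P t s q"
  using P_add[of t s "p - q" q] by simp

lemma P_pderiv: "heat_airy_P t s (pderiv q) = pderiv (heat_airy_P t s q)"
proof -
  have "degree (pderiv q) \<le> degree q" by (simp add: degree_pderiv)
  then show ?thesis
    by (simp add: P_bound[where n = "degree q"] gen_pow_pderiv pderiv_smult
        higher_pderiv_sum[of 1, simplified])
qed

lemma P_pderiv_pow: "heat_airy_P t s ((pderiv ^^ n) q) = (pderiv ^^ n) (heat_airy_P t s q)"
  by (induction n) (simp_all add: P_pderiv)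

lemma gen_pCons: "gen t s (pCons 0 q) = pCons 0 (gen t s q) + (smult t (pderiv q) - smult s (pderiv (pderiv q)))"
  by (rule poly_eqI)
     (auto simp: gen_def numeral_2_eq_2 numeral_3_eq_3 coeff_pCons coeff_pderiv field_simps split: nat.splits)

lemma gen_pow_pCons:
  "(gen t s ^^ n) (pCons 0 q) = pCons 0 ((gen t s ^^ n) q) +
     smult (of_nat n) (smult t (pderiv ((gen t s ^^ (n - 1)) q)) - smult s (pderiv (pderiv ((gen t s ^^ (n - 1)) q))))"
proof (induction n)
  case (Suc n)
  let ?B = "\<lambda>q. smult t (pderiv q) - smult s (pderiv (pderiv q))"
  have B: "gen t s (?B q) = ?B (gen t s q)" for q
    using gen_add[of t s "?B q" "smult s (pderiv (pderiv q))"]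
    by (simp add: gen_smult gen_comm_pderiv algebra_simps)
  have "(gen t s ^^ Suc n) (pCons 0 q) =
      gen t s (pCons 0 ((gen t s ^^ n) q)) + smult (of_nat n) (gen t s (?B ((gen t s ^^ (n - 1)) q)))"
    by (simp add: Suc.IH gen_add gen_smult)
  also have "smult (of_nat n) (gen t s (?B ((gen t s ^^ (n - 1)) q))) = smult (of_nat n) (?B ((gen t s ^^ n) q))"
    unfolding B by (cases n) simp_all
  finally show ?case
    by (simp add: gen_pCons smult_add_left algebra_simps)
qed simp

lemma P_pCons: "heat_airy_P t s (pCons 0 q) = poly_X t s (heat_airy_P t s q)"
proof -
  let ?B = "\<lambda>q. smult t (pderiv q) - smult s (pderiv (pderiv q))"
  let ?n = "degree q" and ?G = "gen t s"
  have ps: "pderiv (sum h S) = (\<Sum>i\<in>S. pderiv (h i))" for h :: "nat \<Rightarrow> real poly" and S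
    using higher_pderiv_sum[of 1] by simp
  have Bs: "?B (sum h S) = (\<Sum>i\<in>S. ?B (h i))" for h :: "nat \<Rightarrow> real poly" and S
    by (simp add: ps smult_sum_right sum_subtractf)
  have "heat_airy_P t s (pCons 0 q) = (\<Sum>k\<le>Suc ?n. smult (1 / fact k) ((?G ^^ k) (pCons 0 q)))"
    by (rule P_bound) (rule degree_pCons_le)
  also have "\<dots> = (\<Sum>k\<le>Suc ?n. pCons 0 (smult (1 / fact k) ((?G ^^ k) q))) +
      (\<Sum>k\<le>Suc ?n. smult (of_nat k / fact k) (?B ((?G ^^ (k - 1)) q)))"
    by (simp add: gen_pow_pCons smult_add_right flip: sum.distrib)
  also have "(\<Sum>k\<le>Suc ?n. pCons 0 (smult (1 / fact k) ((?G ^^ k) q))) =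
      [:0, 1:] * (\<Sum>k\<le>Suc ?n. smult (1 / fact k) ((?G ^^ k) q))"
    by (subst sum_distrib_left) simp
  also have "(\<Sum>k\<le>Suc ?n. smult (1 / fact k) ((?G ^^ k) q)) = heat_airy_P t s q"
    by (rule P_bound [symmetric]) simp
  also have "(\<Sum>k\<le>Suc ?n. smult (of_nat k / fact k) (?B ((?G ^^ (k - 1)) q))) =
      (\<Sum>k\<le>?n. smult (of_nat (Suc k) / fact (Suc k)) (?B ((?G ^^ k) q)))"
    by (subst sum.atMost_Suc_shift) simp
  also have "\<dots> = (\<Sum>k\<le>?n. ?B (smult (1 / fact k) ((?G ^^ k) q)))"
  proof (rule sum.cong)
    fix k
    have "of_nat (Suc k) / fact (Suc k) = (1 / fact k :: real)"
      by (subst fact_Suc) (simp del: of_nat_Suc)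
    then show "smult (of_nat (Suc k) / fact (Suc k)) (?B ((?G ^^ k) q)) = ?B (smult (1 / fact k) ((?G ^^ k) q))"
      by (simp only: pderiv_smult smult_diff_right smult_smult mult.commute)
  qed simp
  also have "\<dots> = ?B (heat_airy_P t s q)"
    by (simp only: Bs [symmetric] P_bound[OF order_refl])
  finally show ?thesis
    by (simp add: poly_X_def algebra_simps)
qed

lemma poly_X_linear:
  "poly_X t s 0 = 0" "poly_X t s (p + q) = poly_X t s p + poly_X t s q"
  "poly_X t s (smult c q) = smult c (poly_X t s q)"
  by (simp_all add: poly_X_def pderiv_add pderiv_smult smult_add_right smult_diff_right mult.commute)

lemma poly_X_sum: "poly_X t s (\<Sum>i\<in>S. q i) = (\<Sum>i\<in>S. poly_X t s (q i))"
  by (induction S rule: infinite_finite_induct) (simp_all add: poly_X_linear)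

lemma P_mult:
  "heat_airy_P t s (a * q) = (\<Sum>i\<le>degree a. smult (coeff a i) ((poly_X t s ^^ i) (heat_airy_P t s q)))"
proof (induction a)
  case (pCons c a)
  let ?h = "heat_airy_P t s q" and ?X = "poly_X t s"
  have "heat_airy_P t s (pCons c a * q) = smult c ?h + ?X (heat_airy_P t s (a * q))"
    by (simp add: P_add P_smult P_pCons)
  also have "?X (heat_airy_P t s (a * q)) = (\<Sum>i\<le>degree a. smult (coeff a i) ((?X ^^ Suc i) ?h))"
    by (simp add: pCons.IH poly_X_sum poly_X_linear)
  also have "smult c ?h + \<dots> = (\<Sum>i\<le>Suc (degree a). smult (coeff (pCons c a) i) ((?X ^^ i) ?h))"
    by (subst sum.atMost_Suc_shift) simp
  also have "\<dots> = (\<Sum>i\<le>degree (pCons c a). smult (coeff (pCons c a) i) ((?X ^^ i) ?h))"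
    by (rule sum.mono_neutral_right) (auto simp: degree_pCons_le coeff_eq_0 not_le simp del: coeff_pCons_Suc)
  finally show ?case .
qed simp

lemma P_op_poly: "heat_airy_P t s (op_poly L q) = op_poly (product_form t s L) (heat_airy_P t s q)"
  by (simp only: op_poly_product_form op_poly_def[of L] P_sum P_mult P_pderiv_pow)

lemma degree_P_minus:
  assumes "degree q \<noteq> 0"
  shows "degree (heat_airy_P t s q - q) < degree q"
proof -
  have "heat_airy_P t s q = q + (\<Sum>k\<in>{1..degree q}. smult (1 / fact k) ((gen t s ^^ k) q))"
    unfolding P_bound[OF order_refl] atMost_atLeast0
    by (subst sum.atLeast_Suc_atMost) simp_all
  moreover have "degree (\<Sum>k\<in>{1..degree q}. smult (1 / fact k) ((gen t s ^^ k) q)) < degree q"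
  proof (rule degree_sum_less)
    fix k assume "k \<in> {1..degree q}"
    then obtain l where k: "k = Suc l" by (cases k) auto
    have "degree ((gen t s ^^ Suc l) q) < degree q"
    proof (induction l)
      case 0
      then show ?case using degree_gen[of t s q] assms by simp
    next
      case (Suc l)
      then show ?case using degree_gen[of t s "(gen t s ^^ Suc l) q"] by simp
    qed
    then show "degree (smult (1 / fact k) ((gen t s ^^ k) q)) < degree q"
      unfolding k by (rule le_less_trans[OF degree_smult_le])
  qed (use assms in simp)
  ultimately show ?thesis by simp
qed

lemma P_const: "degree q = 0 \<Longrightarrow> heat_airy_P t s q = q"
  by (simp add: P_bound[OF order_refl])

theorem bij_heat_airy_P: "bij (heat_airy_P t s)"
proof (rule bijI)
  have zero: "q = 0" if "heat_airy_P t s q = 0" for q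
  proof (cases "degree q = 0")
    case True
    then show ?thesis using that by (simp add: P_const)
  next
    case False
    then show ?thesis using degree_P_minus[of q t s] that by simp
  qed
  show "inj (heat_airy_P t s)"
  proof (rule injI)
    fix p q assume "heat_airy_P t s p = heat_airy_P t s q"
    then have "heat_airy_P t s (p - q) = 0" by (simp add: P_diff)
    then show "p = q" using zero[of "p - q"] by simp
  qed
  have "\<exists>q'. heat_airy_P t s q' = q" for q
  proof (induction "degree q" arbitrary: q rule: less_induct)
    case less
    show ?case
    proof (cases "degree q = 0")
      case True
      then show ?thesis by (blast intro: P_const)
    next
      case False
      then obtain r where "heat_airy_P t s r = heat_airy_P t s q - q"
        using less degree_P_minus by blast
      then have "heat_airy_P t s (q - r) = q" by (simp add: P_diff)
      then show ?thesis by blast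
    qed
  qed
  then show "surj (heat_airy_P t s)" by (metis surjI)
qed

theorem bij_heat_P: "bij (heat_P t)"
  by (simp add: heat_P_eq bij_heat_airy_P)

subsection \<open>The transports\<close>

lemma heat_airy_N_product_form: "heat_airy_N L t s = product_form t s L"
  unfolding heat_airy_N_def conj_op_def
proof (rule the_equality)
  show *: "\<forall>q. op_poly (product_form t s L) q = heat_airy_P t s (op_poly L (inv (heat_airy_P t s) q))"
    by (simp add: P_op_poly bij_is_surj[OF bij_heat_airy_P] surj_f_inv_f)
  show "N = product_form t s L"
    if "\<forall>q. op_poly N q = heat_airy_P t s (op_poly L (inv (heat_airy_P t s) q))" for N
    using that * by (intro op_poly_inject) simp
qed

theorem heat_airy_N_conj:
  "op_poly (heat_airy_N L t s) q = heat_airy_P t s (op_poly L (inv (heat_airy_P t s) q))"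
  by (simp add: heat_airy_N_product_form P_op_poly bij_is_surj[OF bij_heat_airy_P] surj_f_inv_f)

theorem heat_N_conj: "op_poly (heat_N L t) q = heat_P t (op_poly L (inv (heat_P t) q))"
  using heat_airy_N_conj[of L t 0 q] by (simp add: heat_N_def heat_airy_N_def heat_P_eq)

theorem heat_airy_N_fun:
  assumes "\<And>n x. (deriv ^^ n) g field_differentiable (at x)"
  shows "op_fun (heat_airy_N L t s) g x =
    (\<Sum>j\<le>degree L. poly_of_op (coeff L j) (heat_airy_X t s) ((deriv ^^ j) g) x)"
  by (simp add: heat_airy_N_product_form op_fun_product_form[OF assms])

text \<open>The differentiability assumption holds for the spatial slices of a smooth function.\<close>

lemma smooth_slice:
  fixes v :: "real \<Rightarrow> real \<Rightarrow> real \<Rightarrow> real"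
  assumes "smooth_on (I \<times> UNIV) (\<lambda>((t, s), x). v t s x)" "(t, s) \<in> I"
  shows "(deriv ^^ n) (v t s) field_differentiable (at x)"
  using assms(1)
proof (induction n arbitrary: v x)
  case (0 v x)
  let ?g = "\<lambda>((t, s), x). v t s x"
  have "?g differentiable (at ((t, s), x))"
    using spec[OF 0[unfolded smooth_on_def], of "Suc 0"] assms(2) by auto
  then have g: "(?g has_derivative frechet_derivative ?g (at ((t, s), x))) (at ((t, s), x))"
    by (simp add: frechet_derivative_works)
  have "((\<lambda>x. ?g ((t, s), x)) has_derivative (\<lambda>h. frechet_derivative ?g (at ((t, s), x)) ((0, 0), h))) (at x)"
    by (rule has_derivative_compose[where f = "\<lambda>x. ((t, s), x)", OF _ g])
       (auto intro!: derivative_eq_intros simp: zero_prod_def)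
  then have "v t s differentiable (at x)"
    by (auto simp: differentiable_def)
  then obtain d where "(v t s has_real_derivative d) (at x)"
    by (rule real_differentiableE)
  then show ?case
    by (auto simp: field_differentiable_def)
next
  case (Suc n v x)
  let ?g = "\<lambda>((t, s), x). v t s x"
  define w where "w t s x = frechet_derivative ?g (at ((t, s), x)) ((0, 0), 1)" for t s x
  have "(\<lambda>((t, s), x). w t s x) = (\<lambda>z. frechet_derivative ?g (at z) ((0, 0), 1))"
    by (auto simp: w_def fun_eq_iff)
  then have w: "smooth_on (I \<times> UNIV) (\<lambda>((t, s), x). w t s x)"
    using Suc.prems unfolding smooth_on_def by (metis Ck_on.simps(2))
  have "deriv (v t s) = w t s"
  proof
    fix y
    have "?g differentiable (at ((t, s), y))"
      using spec[OF Suc.prems[unfolded smooth_on_def], of "Suc 0"] assms(2) by auto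
    then have g: "(?g has_derivative frechet_derivative ?g (at ((t, s), y))) (at ((t, s), y))"
      by (simp add: frechet_derivative_works)
    have 1: "((\<lambda>x. ?g ((t, s), x)) has_derivative (\<lambda>h. frechet_derivative ?g (at ((t, s), y)) ((0, 0), h))) (at y)"
      by (rule has_derivative_compose[where f = "\<lambda>x. ((t, s), x)", OF _ g])
         (auto intro!: derivative_eq_intros simp: zero_prod_def)
    have "frechet_derivative ?g (at ((t, s), y)) ((0, 0), h) = w t s y * h" for h
      using linear_scale[OF has_derivative_linear[OF g], of h "((0, 0), 1)"]
      by (simp add: w_def mult.commute)
    with 1 have "(v t s has_field_derivative w t s y) (at y)"
      by (simp add: has_field_derivative_def)
    then show "deriv (v t s) y = w t s y"
      by (rule DERIV_imp_deriv)
  qed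
  then show ?case
    using Suc.IH[OF w, of x] by (simp add: funpow_Suc_right del: funpow.simps)
qed

theorem heat_N_fun:
  assumes "\<And>n x. (deriv ^^ n) g field_differentiable (at x)"
  shows "op_fun (heat_N L t) g x =
    (\<Sum>j\<le>degree L. poly_of_op (coeff L j) (heat_X t) ((deriv ^^ j) g) x)"
proof -
  have "heat_X t = heat_airy_X t 0"
    by (simp add: heat_X_def heat_airy_X_def fun_eq_iff)
  then show ?thesis
    using heat_airy_N_fun[OF assms, of L t 0 x] by (simp add: heat_N_def heat_airy_N_def heat_P_eq)
qed

end

theory Submission
  imports Defs
begin

text \<open>At s = 0 the cubic term of the exponent vanishes, so \<open>heat_airy_P t 0\<close> is
  \<open>heat_P t\<close> and the two conjugates of L coincide (\<open>heat_N_eq\<close>). The jets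
  differentiate only in x, with t and s held fixed, so setting s = 0 commutes with D^r and with the
  boundary trace (\<open>heat_airy_jet_slice\<close>).\<close>

lemma heat_N_eq: "heat_N L t = heat_airy_N L t 0"
  by (simp add: heat_N_def heat_airy_N_def heat_P_eq)

text \<open>Stated at a single t, because \<open>u\<close> and \<open>F\<close> are tied to
  \<open>v\<close> and \<open>f\<close> only where (t, 0) lies in I.\<close>

lemma heat_airy_jet_slice:
  assumes "\<And>x. u t x = v t 0 x" and "F t = f t 0"
  shows "heat_airy_jet L f v r t 0 = heat_jet L F u r t"
proof -
  \<comment> \<open>Equality as functions of x: the jet differentiates before evaluating at the
    boundary, so agreement at \<open>F t\<close> alone would not suffice.\<close>
  have "u t = v t 0"
    using assms(1) by (rule ext)
  then show ?thesis
    by (simp add: heat_airy_jet_def heat_jet_def gamma1_def gamma2_def heat_N_eq assms(2))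
qed

theorem proposition7p1:
  fixes L :: "real poly poly"
    and I :: "(real \<times> real) set"
    and f :: "real \<Rightarrow> real \<Rightarrow> real"
    and v :: "real \<Rightarrow> real \<Rightarrow> real \<Rightarrow> real"
    and u :: "real \<Rightarrow> real \<Rightarrow> real"
    and F :: "real \<Rightarrow> real"
  assumes "open I"
    and "smooth_on I (\<lambda>(t, s). f t s)"
    and "smooth_on (I \<times> UNIV) (\<lambda>((t, s), x). v t s x)"
    and "\<And>t s x. (t, s) \<in> I \<Longrightarrow> deriv (\<lambda>t'. v t' s x) t = 1 / 2 * (deriv ^^ 2) (v t s) x"
    and "\<And>t s x. (t, s) \<in> I \<Longrightarrow> deriv (\<lambda>s'. v t s' x) s = - (1 / 3) * (deriv ^^ 3) (v t s) x"
    and "\<And>t s x. (t, s) \<in> I \<Longrightarrow> op_fun (heat_airy_N L t s) (v t s) x = 0"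
    and "\<And>t s. (t, s) \<in> I \<Longrightarrow> v t s (f t s) = 0"
    and "\<And>t x. (t, 0) \<in> I \<Longrightarrow> u t x = v t 0 x"
    and "\<And>t. (t, 0) \<in> I \<Longrightarrow> F t = f t 0"
  shows "(\<forall>r t. (t, 0) \<in> I \<longrightarrow> heat_airy_jet L f v r t 0 = heat_jet L F u r t) \<and>
         (\<forall>R. finite R \<longrightarrow>
           (\<lambda>r\<in>R. \<lambda>t\<in>{t. (t, 0) \<in> I}. heat_jet L F u r t) =
             (\<lambda>r\<in>R. \<lambda>t\<in>{t. (t, 0) \<in> I}. heat_airy_jet L f v r t 0) \<and>
           {t. (t, 0) \<in> I \<and> (\<forall>r\<in>R. heat_jet L F u r t = 0)} =
             {t. (t, 0) \<in> {(t, s). (t, s) \<in> I \<and> (\<forall>r\<in>R. heat_airy_jet L f v r t s = 0)}})"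
proof -
  have jet: "heat_airy_jet L f v r t 0 = heat_jet L F u r t" if "(t, 0) \<in> I" for r t
    using assms(8,9)[OF that] by (rule heat_airy_jet_slice)
  \<comment> \<open>Outside R and outside the slice of I both restricted families take the default
    value \<open>undefined\<close>; inside, \<open>jet\<close> applies. It also identifies the Heat
    solution set with the s = 0 slice of the Heat-Airy one.\<close>
  then show ?thesis
    by (auto simp: restrict_def fun_eq_iff)
qed

end
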